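(* Let $G$ be a connected $(P_7, C_4, \text{diamond})$-free graph that has no clique cutset. If $G$ is isomorphic neither to $F$ nor to the Petersen graph, then $\delta(G)\le \max\{2,\omega(G)-1\}$.
   Context: All graphs are finite and simple. $P_t$ and $C_t$ denote the path and the cycle on $t$ vertices. For a graph $H$, a graph $G$ is $H$-free if no induced subgraph of $G$ is isomorphic to $H$; $G$ is $(H_1,H_2,\dots)$-free if it is $H_i$-free for every $i$. A diamond is the graph obtained from two triangles sharing exactly one edge (i.e. $K_4$ minus an edge). A clique cutset of $G$ is a clique $K$ of $G$ such that $G-K$ has more connected components than $G$. $\delta(G)$ is the minimum degree and $\omega(G)$ the clique number. The graph $F$ is obtained from a $7$-hole (induced cycle) $v_1v_2v_3v_4v_5v_6v_7v_1$ by adding a stable set $\{y_1,y_2,y_3\}$ with $N(y_1)=\{v_1,v_4,v_5\}$, $N(y_2)=\{v_2,v_5,v_6\}$, $N(y_3)=\{v_3,v_6,v_7\}$ and no other edges. *)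

theory Defs
  imports Main
begin

definition sgraph :: "'a set \<Rightarrow> ('a \<Rightarrow> 'a \<Rightarrow> bool) \<Rightarrow> bool" where
  "sgraph V E \<longleftrightarrow> finite V \<and> (\<forall>x y. E x y \<longrightarrow> x \<in> V \<and> y \<in> V)
     \<and> (\<forall>x y. E x y \<longrightarrow> E y x) \<and> (\<forall>x. \<not> E x x)"

definition has_induced :: "'b set \<Rightarrow> ('b \<Rightarrow> 'b \<Rightarrow> bool) \<Rightarrow> 'a set \<Rightarrow> ('a \<Rightarrow> 'a \<Rightarrow> bool) \<Rightarrow> bool" where
  "has_induced HV HE V E \<longleftrightarrow> (\<exists>f. inj_on f HV \<and> f ` HV \<subseteq> V \<and>
      (\<forall>x\<in>HV. \<forall>y\<in>HV. HE x y \<longleftrightarrow> E (f x) (f y)))"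

definition graph_iso :: "'b set \<Rightarrow> ('b \<Rightarrow> 'b \<Rightarrow> bool) \<Rightarrow> 'a set \<Rightarrow> ('a \<Rightarrow> 'a \<Rightarrow> bool) \<Rightarrow> bool" where
  "graph_iso HV HE V E \<longleftrightarrow> (\<exists>f. bij_betw f HV V \<and>
      (\<forall>x\<in>HV. \<forall>y\<in>HV. HE x y \<longleftrightarrow> E (f x) (f y)))"

definition path_E :: "nat \<Rightarrow> nat \<Rightarrow> bool" where
  "path_E i j \<longleftrightarrow> i + 1 = j \<or> j + 1 = i"

text \<open>Cycle C_t (t \<ge> 3) on vertices 0..t-1.\<close>
definition cycle_E :: "nat \<Rightarrow> nat \<Rightarrow> nat \<Rightarrow> bool" where
  "cycle_E t i j \<longleftrightarrow> i < t \<and> j < t \<and> ((i + 1) mod t = j \<or> (j + 1) mod t = i)"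

definition diamond_E :: "nat \<Rightarrow> nat \<Rightarrow> bool" where
  "diamond_E i j \<longleftrightarrow> i < 4 \<and> j < 4 \<and> i \<noteq> j \<and> {i, j} \<noteq> {0, 3}"

text \<open>The graph F: 7-hole v1..v7 = 0..6, y1 = 7, y2 = 8, y3 = 9 with
N(y1)={v1,v4,v5}, N(y2)={v2,v5,v6}, N(y3)={v3,v6,v7}.\<close>
definition F_E :: "nat \<Rightarrow> nat \<Rightarrow> bool" where
  "F_E i j \<longleftrightarrow> cycle_E 7 i j \<or>
     {i, j} \<in> {{7,0},{7,3},{7,4},{8,1},{8,4},{8,5},{9,2},{9,5},{9,6}}"

text \<open>Petersen graph as the Kneser graph K(5,2).\<close>
definition petersen_V :: "nat set set" where
  "petersen_V = {S. S \<subseteq> {0..<5} \<and> card S = 2}"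

definition petersen_E :: "nat set \<Rightarrow> nat set \<Rightarrow> bool" where
  "petersen_E S T \<longleftrightarrow> S \<in> petersen_V \<and> T \<in> petersen_V \<and> S \<inter> T = {}"

definition reach_in :: "'a set \<Rightarrow> ('a \<Rightarrow> 'a \<Rightarrow> bool) \<Rightarrow> 'a \<Rightarrow> 'a \<Rightarrow> bool" where
  "reach_in S E = (\<lambda>x y. E x y \<and> x \<in> S \<and> y \<in> S)\<^sup>*\<^sup>*"

definition components_in :: "'a set \<Rightarrow> ('a \<Rightarrow> 'a \<Rightarrow> bool) \<Rightarrow> 'a set set" where
  "components_in S E = {{y \<in> S. reach_in S E x y} | x. x \<in> S}"

definition connected_graph :: "'a set \<Rightarrow> ('a \<Rightarrow> 'a \<Rightarrow> bool) \<Rightarrow> bool" where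
  "connected_graph V E \<longleftrightarrow> V \<noteq> {} \<and> (\<forall>x\<in>V. \<forall>y\<in>V. reach_in V E x y)"

definition is_clique :: "'a set \<Rightarrow> ('a \<Rightarrow> 'a \<Rightarrow> bool) \<Rightarrow> 'a set \<Rightarrow> bool" where
  "is_clique V E K \<longleftrightarrow> K \<subseteq> V \<and> (\<forall>x\<in>K. \<forall>y\<in>K. x \<noteq> y \<longrightarrow> E x y)"

definition clique_cutset :: "'a set \<Rightarrow> ('a \<Rightarrow> 'a \<Rightarrow> bool) \<Rightarrow> 'a set \<Rightarrow> bool" where
  "clique_cutset V E K \<longleftrightarrow> is_clique V E K \<and>
     card (components_in (V - K) E) > card (components_in V E)"

definition degree :: "'a set \<Rightarrow> ('a \<Rightarrow> 'a \<Rightarrow> bool) \<Rightarrow> 'a \<Rightarrow> nat" where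
  "degree V E v = card {u \<in> V. E v u}"

definition min_degree :: "'a set \<Rightarrow> ('a \<Rightarrow> 'a \<Rightarrow> bool) \<Rightarrow> nat" where
  "min_degree V E = Min (degree V E ` V)"

definition clique_number :: "'a set \<Rightarrow> ('a \<Rightarrow> 'a \<Rightarrow> bool) \<Rightarrow> nat" where
  "clique_number V E = Max (card ` {K. is_clique V E K})"

end

theory Submission
  imports Defs
begin

text \<open>
  A graph is \<open>C\<^sub>4\<close>- and diamond-free iff any two non-adjacent vertices have at most one common
  neighbour, so neighbourhoods are disjoint unions of cliques. If the minimum degree exceeds
  \<open>max 2 (\<omega> - 1)\<close>, then every vertex has at least three neighbours and its neighbourhood is not a
  clique. Hence an induced subgraph in which some vertex violates one of these two conditions
  extends by a further neighbour of that vertex, and there are few ways to do so without creating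
  a long induced path. Exhausting them starting from \<open>P\<^sub>6\<close>, \<open>P\<^sub>5\<close> and \<open>K\<^sub>1\<close>, while forbidding \<open>P\<^sub>7\<close>,
  \<open>P\<^sub>6\<close> and \<open>P\<^sub>5\<close> respectively, leaves the Petersen graph only.
\<close>

section \<open>Adjacency matrices and induced paths\<close>

type_synonym matrix = "bool list list"

definition adj :: "('a \<Rightarrow> 'a \<Rightarrow> bool) \<Rightarrow> 'a list \<Rightarrow> matrix" where
  "adj E xs = map (\<lambda>x. map (E x) xs) xs"

lemma length_adj [simp]: "length (adj E xs) = length xs"
  by (simp add: adj_def)

lemma nth_adj [simp]: "i < length xs \<Longrightarrow> adj E xs ! i = map (E (xs ! i)) xs"
  by (simp add: adj_def)

lemma adj_eq_iff:
  "adj E xs = adj H ys \<longleftrightarrow> length xs = length ys \<and>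
     (\<forall>i<length xs. \<forall>j<length xs. E (xs ! i) (xs ! j) \<longleftrightarrow> H (ys ! i) (ys ! j))"
proof -
  have "adj E xs = adj H ys \<longleftrightarrow> length xs = length ys \<and>
      (\<forall>i<length xs. map (E (xs ! i)) xs = map (H (ys ! i)) ys)"
    by (auto simp: list_eq_iff_nth_eq[of "adj E xs"])
  also have "\<dots> \<longleftrightarrow> length xs = length ys \<and>
      (\<forall>i<length xs. \<forall>j<length xs. E (xs ! i) (xs ! j) \<longleftrightarrow> H (ys ! i) (ys ! j))"
    by (auto simp: list_eq_iff_nth_eq)
  finally show ?thesis .
qed

text \<open>Listing the values of an embedding turns induced containment into an equation between
  Boolean matrices, which can be computed with.\<close>

lemma has_induced_iff_adj:
  "has_induced {0..<n} H V E \<longleftrightarrow>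
     (\<exists>xs. distinct xs \<and> set xs \<subseteq> V \<and> adj E xs = adj H [0..<n])"
proof
  assume "has_induced {0..<n} H V E"
  then obtain f where f: "inj_on f {0..<n}" "f ` {0..<n} \<subseteq> V"
      "\<forall>x\<in>{0..<n}. \<forall>y\<in>{0..<n}. H x y \<longleftrightarrow> E (f x) (f y)"
    unfolding has_induced_def by blast
  have "distinct (map f [0..<n])" "set (map f [0..<n]) \<subseteq> V"
    using f(1,2) by (simp_all add: distinct_map)
  moreover have "adj E (map f [0..<n]) = adj H [0..<n]"
    using f(3) by (simp add: adj_eq_iff)
  ultimately show "\<exists>xs. distinct xs \<and> set xs \<subseteq> V \<and> adj E xs = adj H [0..<n]" by blast
next
  assume "\<exists>xs. distinct xs \<and> set xs \<subseteq> V \<and> adj E xs = adj H [0..<n]"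
  then obtain xs where xs: "distinct xs" "set xs \<subseteq> V" "adj E xs = adj H [0..<n]" by blast
  have "length xs = n" and E: "\<forall>i<n. \<forall>j<n. E (xs ! i) (xs ! j) \<longleftrightarrow> H i j"
    using xs(3) by (auto simp: adj_eq_iff)
  then have "inj_on ((!) xs) {0..<n}" "(!) xs ` {0..<n} \<subseteq> V"
    using xs(1,2) by (auto simp: inj_on_def nth_eq_iff_index_eq)
  with E show "has_induced {0..<n} H V E"
    unfolding has_induced_def by (intro exI[of _ "(!) xs"]) auto
qed

lemma graph_iso_if_adj_eq:
  assumes "adj E xs = adj H ys" "distinct xs" "distinct ys"
  shows "graph_iso (set ys) H (set xs) E"
proof -
  have len: "length xs = length ys"
    and E: "\<forall>i<length xs. \<forall>j<length xs. E (xs ! i) (xs ! j) \<longleftrightarrow> H (ys ! i) (ys ! j)"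
    using assms(1) by (auto simp: adj_eq_iff)
  obtain f where f: "\<forall>i<length ys. f (ys ! i) = xs ! i"
  proof
    \<comment> \<open>Matching positions defines the isomorphism; distinctness of \<open>ys\<close>
      makes the lookup find the right entry.\<close>
    show "\<forall>i<length ys. the (map_of (zip ys xs) (ys ! i)) = xs ! i"
      using len assms(3) by (simp add: map_of_zip_nth)
  qed
  have "bij_betw f (set ys) (set xs)"
    unfolding bij_betw_def
  proof
    show "inj_on f (set ys)"
      using f len assms(2) by (auto simp: inj_on_def in_set_conv_nth nth_eq_iff_index_eq)
    have "map f ys = xs"
      using f len by (simp add: list_eq_iff_nth_eq)
    then show "f ` set ys = set xs"
      by (metis set_map)
  qed
  moreover have "\<forall>x\<in>set ys. \<forall>y\<in>set ys. H x y \<longleftrightarrow> E (f x) (f y)"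
    using E f len by (auto simp: in_set_conv_nth)
  ultimately show ?thesis
    unfolding graph_iso_def by blast
qed

text \<open>Built by prepending, as in \<open>grow\<close>. Edges are tested only from earlier to
  later vertices; symmetry supplies the rest in \<open>ipath_nth\<close>.\<close>

fun ipath :: "('a \<Rightarrow> 'a \<Rightarrow> bool) \<Rightarrow> 'a list \<Rightarrow> bool" where
  "ipath E [] \<longleftrightarrow> True"
| "ipath E (x # p) \<longleftrightarrow> x \<notin> set p \<and> (\<forall>i<length p. E x (p ! i) \<longleftrightarrow> i = 0) \<and> ipath E p"

lemma distinct_ipath: "ipath E p \<Longrightarrow> distinct p"
  by (induction p) auto

lemma ipath_nth:
  assumes "\<And>x y. E x y \<Longrightarrow> E y x" "\<And>x. \<not> E x x"
  shows "ipath E p \<Longrightarrow> i < length p \<Longrightarrow> j < length p \<Longrightarrow> E (p ! i) (p ! j) \<longleftrightarrow> path_E i j"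
proof (induction p arbitrary: i j)
  case (Cons x p)
  have "E (p ! k) x \<longleftrightarrow> E x (p ! k)" for k
    using assms(1) by blast
  moreover have "\<not> E x x"
    by (rule assms(2))
  ultimately show ?case
    using Cons by (cases i; cases j) (auto simp: path_E_def)
qed simp

lemma has_induced_path_if_ipath:
  assumes "\<And>x y. E x y \<Longrightarrow> E y x" "\<And>x. \<not> E x x" "ipath E p" "set p \<subseteq> V"
  shows "has_induced {0..<length p} path_E V E"
  unfolding has_induced_iff_adj
  using assms(3,4) distinct_ipath ipath_nth[where E = E, OF assms(1,2)]
  by (intro exI[of _ p]) (auto simp: adj_eq_iff)

section \<open>Extending induced subgraphs\<close>

text \<open>On adjacency rows of two vertices this counts their common neighbours.\<close>

definition meet :: "bool list \<Rightarrow> bool list \<Rightarrow> nat" where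
  "meet r s = length (filter (\<lambda>(a, b). a \<and> b) (zip r s))"

definition rows_at :: "bool list \<Rightarrow> matrix \<Rightarrow> matrix" where
  "rows_at r R = map snd (filter fst (zip r R))"

text \<open>\<open>grow k R r c\<close>: a vertex with row \<open>r\<close> starts an induced path with \<open>k\<close> further vertices,
  all taken from the mask \<open>c\<close>.\<close>
fun grow :: "nat \<Rightarrow> matrix \<Rightarrow> bool list \<Rightarrow> bool list \<Rightarrow> bool" where
  "grow 0 R r c = True"
| "grow (Suc k) R r c = list_ex (\<lambda>s. grow k R s (map2 (\<lambda>a b. \<not> a \<and> b) r c)) (rows_at (map2 (\<and>) r c) R)"

text \<open>Lists the indicator rows of all sets of pairwise compatible vertices, that is, the
  stable sets of the conflict graph. Taking \<open>tl c\<close> skips the diagonal.\<close>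

fun stable_rows :: "matrix \<Rightarrow> matrix" where
  "stable_rows [] = [[]]"
| "stable_rows (c # M) = concat (map (\<lambda>r. if list_all2 (\<le>) r (tl c) then [False # r, True # r] else [False # r])
     (stable_rows (map tl M)))"

text \<open>Non-adjacent vertices that already share a neighbour cannot both be joined to a new
  vertex.\<close>

definition compat :: "matrix \<Rightarrow> matrix" where
  "compat R = map (\<lambda>r. map2 (\<lambda>a s. a \<or> meet r s = 0) r R) R"

text \<open>The possible rows of an additional vertex satisfying \<open>P\<close>. Looking only at those paths on
  \<open>k + 1\<close> vertices that start in the new vertex keeps the test cheap and loses little.\<close>
definition new_rows :: "nat \<Rightarrow> (bool list \<Rightarrow> bool) \<Rightarrow> matrix \<Rightarrow> matrix" where
  "new_rows k P R = filter (\<lambda>t. \<not> grow k R t (map (\<lambda>_. True) t))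
     (filter (\<lambda>t. list_all (\<lambda>s. meet t s \<le> 1) (rows_at (map Not t) R))
     (filter P (stable_rows (compat R))))"

definition add_row :: "matrix \<Rightarrow> bool list \<Rightarrow> matrix" where
  "add_row R t = map2 (\<lambda>r b. r @ [b]) R t @ [t @ [False]]"

text \<open>A vertex whose neighbours form a clique needs a neighbour adjacent to none of them;
  a vertex of degree at most two needs some further neighbour. The count is \<open>1\<close> in the first test
  because a neighbour is not adjacent to itself.\<close>
definition demand :: "matrix \<Rightarrow> (bool list \<Rightarrow> bool) option" where
  "demand R = (case find (\<lambda>i. list_all (\<lambda>s. meet (R ! i) (map Not s) = 1) (rows_at (R ! i) R)) [0..<length R] of
     Some i \<Rightarrow> Some (\<lambda>t. t ! i \<and> meet t (R ! i) = 0)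
   | None \<Rightarrow> (case find (\<lambda>i. length (filter id (R ! i)) \<le> 2) [0..<length R] of
       Some i \<Rightarrow> Some (\<lambda>t. t ! i) | None \<Rightarrow> None))"

text \<open>The second argument bounds the number of added vertices. A matrix is also returned when
  the bound is reached, so an empty result always means that every branch died.\<close>

fun search :: "nat \<Rightarrow> nat \<Rightarrow> matrix \<Rightarrow> matrix list" where
  "search k 0 R = [R]"
| "search k (Suc n) R = (case demand R of None \<Rightarrow> [R]
    | Some P \<Rightarrow> concat (map (\<lambda>t. search k n (add_row R t)) (new_rows k P R)))"

section \<open>Completeness of the search\<close>

lemma filter_zip_map_map:
  "filter P (zip (map f xs) (map g xs)) = map (\<lambda>x. (f x, g x)) (filter (\<lambda>x. P (f x, g x)) xs)"
  by (induction xs) auto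

lemma meet_map [simp]: "meet (map P xs) (map Q xs) = length (filter (\<lambda>x. P x \<and> Q x) xs)"
  by (simp add: meet_def filter_zip_map_map)

lemma rows_at_map: "rows_at (map P xs) (map f xs) = map f (filter P xs)"
  by (simp add: rows_at_def filter_zip_map_map)

lemma rows_at_adj: "rows_at (map P xs) (adj E xs) = map (\<lambda>x. map (E x) xs) (filter P xs)"
  by (simp add: adj_def rows_at_map)

lemma compat_adj:
  "compat (adj E xs) =
     map (\<lambda>x. map (\<lambda>y. E x y \<or> (\<forall>z\<in>set xs. \<not> (E x z \<and> E y z))) xs) xs"
  by (simp add: compat_def adj_def map2_map_map filter_empty_conv)

lemma stable_rows_complete:
  assumes "distinct xs" "\<And>x y. x \<in> set xs \<Longrightarrow> y \<in> set xs \<Longrightarrow> x \<noteq> y \<Longrightarrow> Q x \<Longrightarrow> Q y \<Longrightarrow> C x y"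
  shows "map Q xs \<in> set (stable_rows (map (\<lambda>x. map (C x) xs) xs))"
  using assms
proof (induction xs)
  case (Cons a xs)
  have IH: "map Q xs \<in> set (stable_rows (map (\<lambda>x. map (C x) xs) xs))"
    using Cons by simp
  have "Q a \<Longrightarrow> list_all2 (\<le>) (map Q xs) (map (C a) xs)"
    using Cons.prems by (auto simp: list_all2_map1 list_all2_map2 list_all2_same)
  then show ?case
    using IH by (auto simp: comp_def intro!: bexI[of _ "map Q xs"])
qed simp

text \<open>\<open>common_unique\<close> combines the exclusion of \<open>C\<^sub>4\<close> and the
  diamond. Given it, \<open>not_simplicial\<close> says that no neighbourhood of a vertex with a
  neighbour is a clique: a neighbour \<open>u\<close> of \<open>x\<close> adjacent to all others
  would, with \<open>x\<close>, be a second common neighbour of any non-adjacent pair.\<close>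

locale sparse_graph =
  fixes V :: "'a set" and E :: "'a \<Rightarrow> 'a \<Rightarrow> bool"
  assumes sym: "E x y \<Longrightarrow> E y x"
    and irrefl: "\<not> E x x"
    and vertices: "E x y \<Longrightarrow> y \<in> V"
    and common_unique: "x \<noteq> y \<Longrightarrow> \<not> E x y \<Longrightarrow> E u x \<Longrightarrow> E u y \<Longrightarrow> E v x \<Longrightarrow> E v y \<Longrightarrow> u = v"
    and degree_ge_3: "x \<in> V \<Longrightarrow> 3 \<le> card {y. E x y}"
    and not_simplicial: "E x u \<Longrightarrow> \<exists>w. E x w \<and> w \<noteq> u \<and> \<not> E u w"
begin

text \<open>The mask always excludes the current head and, after each step, all neighbours of
  earlier heads; this makes the path induced and its vertices distinct.\<close>

lemma grow_imp_ipath: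
  assumes "grow k (adj E xs) (map (E h) xs) (map P xs)" "\<not> P h"
  shows "\<exists>p. length p = k \<and> set p \<subseteq> set xs \<and> (\<forall>u\<in>set p. P u) \<and> ipath E (h # p)"
  using assms
proof (induction k arbitrary: h P)
  case (Suc k)
  define Q where "Q = (\<lambda>u. \<not> E h u \<and> P u)"
  obtain v where v: "v \<in> set xs" "E h v" "P v" and g: "grow k (adj E xs) (map (E v) xs) (map Q xs)"
    using Suc.prems(1) by (auto simp: map2_map_map rows_at_adj list_ex_iff Q_def)
  have "\<not> Q v"
    using v by (simp add: Q_def)
  then obtain p where p: "length p = k" "set p \<subseteq> set xs" "\<forall>u\<in>set p. Q u" "ipath E (v # p)"
    using Suc.IH[OF g] by blast
  have "h \<notin> set (v # p)"
    using p(3) v Suc.prems(2) irrefl by (auto simp: Q_def)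
  moreover have "E h ((v # p) ! i) \<longleftrightarrow> i = 0" if "i < length (v # p)" for i
    using that v p(3) by (cases i) (auto simp: Q_def)
  ultimately have "ipath E (h # v # p)"
    using p(4) by (simp only: ipath.simps) simp
  then show ?case
    using p(1-3) v by (intro exI[of _ "v # p"]) (auto simp: Q_def)
qed simp

text \<open>Every filter is a necessary condition: the first two follow from
  \<open>common_unique\<close>, the last from the absence of a path on \<open>k + 1\<close>
  vertices.\<close>

lemma new_rows_complete:
  assumes "distinct xs" "set xs \<subseteq> V" "w \<in> V" "w \<notin> set xs" "P (map (E w) xs)"
    and no_path: "\<not> has_induced {0..<Suc k} path_E V E"
  shows "map (E w) xs \<in> set (new_rows k P (adj E xs))"
proof -
  let ?t = "map (E w) xs"
  have "?t \<in> set (stable_rows (compat (adj E xs)))"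
    unfolding compat_adj
  proof (rule stable_rows_complete[OF assms(1)])
    fix x y assume "x \<in> set xs" "y \<in> set xs" "x \<noteq> y" "E w x" "E w y"
    then show "E x y \<or> (\<forall>z\<in>set xs. \<not> (E x z \<and> E y z))"
      using common_unique[of x y w] sym assms(4) by metis
  qed
  moreover have "list_all (\<lambda>s. meet ?t s \<le> 1) (rows_at (map Not ?t) (adj E xs))"
  proof -
    have "length (filter (\<lambda>y. E w y \<and> E x y) xs) \<le> 1" if "x \<in> set xs" "\<not> E w x" for x
    proof -
      have "w \<noteq> x"
        using that assms(4) by blast
      then have "y = z" if "E w y \<and> E x y" "E w z \<and> E x z" for y z
        using common_unique[of w x y z] that \<open>\<not> E w x\<close> sym by blast
      then have "card {y \<in> set xs. E w y \<and> E x y} \<le> 1"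
        by (auto simp: card_le_Suc0_iff_eq)
      then show ?thesis
        using distinct_card[OF distinct_filter[OF assms(1), of "\<lambda>y. E w y \<and> E x y"]] by simp
    qed
    then show ?thesis
      by (simp add: rows_at_adj comp_def list_all_iff)
  qed
  moreover have "\<not> grow k (adj E xs) ?t (map (\<lambda>_. True) ?t)"
  proof
    assume g: "grow k (adj E xs) ?t (map (\<lambda>_. True) ?t)"
    \<comment> \<open>The full mask is rewritten so that its predicate fails at the head
      \<open>w\<close>, as \<open>grow_imp_ipath\<close> requires.\<close>
    have "map (\<lambda>_. True) ?t = map (\<lambda>u. u \<noteq> w) xs"
      using assms(4) by auto
    then obtain p where "length p = k" "set p \<subseteq> set xs" "ipath E (w # p)"
      using grow_imp_ipath[of k xs w "\<lambda>u. u \<noteq> w"] g by metis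
    moreover from this have "set (w # p) \<subseteq> V"
      using assms(2,3) by auto
    ultimately show False
      using has_induced_path_if_ipath[of E "w # p" V] sym irrefl no_path by auto
  qed
  ultimately show ?thesis
    using assms(5) by (simp add: new_rows_def)
qed

lemma demand_satisfied:
  assumes "distinct xs" "set xs \<subseteq> V" "demand (adj E xs) = Some P"
  shows "\<exists>w\<in>V. w \<notin> set xs \<and> P (map (E w) xs)"
proof (cases "find (\<lambda>i. list_all (\<lambda>s. meet (adj E xs ! i) (map Not s) = 1)
    (rows_at (adj E xs ! i) (adj E xs))) [0..<length (adj E xs)]")
  case None
  then obtain i where i: "i < length xs" "length (filter id (adj E xs ! i)) \<le> 2"
      and P: "P = (\<lambda>t. t ! i)"
    using assms(3) by (auto simp: demand_def find_Some_iff split: option.splits)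
  have "card (set (filter (E (xs ! i)) xs)) \<le> 2"
    using i card_length[of "filter (E (xs ! i)) xs"] by (simp add: filter_map comp_def)
  moreover have "3 \<le> card {y. E (xs ! i) y}"
    using i(1) assms(2) degree_ge_3[of "xs ! i"] nth_mem by blast
  ultimately have "\<not> {y. E (xs ! i) y} \<subseteq> set (filter (E (xs ! i)) xs)"
    using card_mono[OF finite_set, of "{y. E (xs ! i) y}" "filter (E (xs ! i)) xs"] by linarith
  then obtain w where "E (xs ! i) w" "w \<notin> set xs"
    by auto
  then show ?thesis
    using i(1) P sym vertices by auto
next
  case (Some i)
  define x where "x = xs ! i"
  have i: "i < length xs"
    and "list_all (\<lambda>s. meet (adj E xs ! i) (map Not s) = 1) (rows_at (adj E xs ! i) (adj E xs))"
    using Some by (auto simp: find_Some_iff)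
  then have one: "length (filter (\<lambda>y. E x y \<and> \<not> E u y) xs) = 1" if "u \<in> set xs" "E x u" for u
    using that by (simp add: rows_at_adj list_all_iff x_def comp_def)
  have clique: "E u y" if "u \<in> set xs" "E x u" "y \<in> set xs" "E x y" "y \<noteq> u" for u y
  proof (rule ccontr)
    assume "\<not> E u y"
    \<comment> \<open>The vertex \<open>u\<close> is its own non-neighbour, so \<open>y\<close>
      would raise the count to two.\<close>
    then have "{u, y} \<subseteq> set (filter (\<lambda>y. E x y \<and> \<not> E u y) xs)"
      using that irrefl by auto
    then have "card {u, y} \<le> card (set (filter (\<lambda>y. E x y \<and> \<not> E u y) xs))"
      by (rule card_mono[OF finite_set])
    then show False
      using one[OF that(1,2)] card_length[of "filter (\<lambda>y. E x y \<and> \<not> E u y) xs"] that(5) by simp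
  qed
  have P: "P = (\<lambda>t. t ! i \<and> meet t (adj E xs ! i) = 0)"
    using assms(3) Some by (simp add: demand_def)
  have "\<exists>w. E x w \<and> w \<notin> set xs \<and> (\<forall>y\<in>set xs. \<not> (E w y \<and> E x y))"
  proof (cases "\<exists>u\<in>set xs. E x u")
    case True
    then obtain u where u: "u \<in> set xs" "E x u"
      by blast
    then obtain w where w: "E x w" "w \<noteq> u" "\<not> E u w"
      using not_simplicial by blast
    \<comment> \<open>Otherwise the non-adjacent \<open>u\<close> and \<open>w\<close> would have
      both \<open>x\<close> and \<open>y\<close> as common neighbours.\<close>
    moreover have "\<not> (E w y \<and> E x y)" if "y \<in> set xs" for y
    proof
      assume y: "E w y \<and> E x y"
      then have "y \<noteq> u"
        using w(3) sym by blast
      then have "E u y"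
        using clique u that y by blast
      then have "x = y"
        using common_unique[of u w x y] u w y sym by blast
      then show False
        using y irrefl by blast
    qed
    moreover have "w \<notin> set xs"
      using clique u w by blast
    ultimately show ?thesis
      by blast
  next
    \<comment> \<open>The clique test passed vacuously, and any neighbour of \<open>x\<close> will
      do.\<close>
    case False
    have "x \<in> V"
      using assms(2) i x_def by auto
    then have "{y. E x y} \<noteq> {}"
      using degree_ge_3[of x] by force
    with False show ?thesis
      by blast
  qed
  then show ?thesis
    using i P sym vertices by (auto simp: x_def filter_empty_conv)
qed

lemma adj_snoc: "adj E (xs @ [w]) = add_row (adj E xs) (map (E w) xs)"
proof -
  have "E w = (\<lambda>x. E x w)"
    using sym by blast
  then have "map (E w) xs = map (\<lambda>x. E x w) xs"
    by metis
  then show ?thesis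
    using irrefl by (simp add: add_row_def adj_def map2_map_map)
qed

text \<open>Repeatedly choosing an actual vertex of \<open>V\<close> that meets the demand follows
  one branch of the search to a leaf.\<close>

lemma search_complete:
  assumes "distinct xs" "set xs \<subseteq> V" "\<not> has_induced {0..<Suc k} path_E V E"
  shows "\<exists>ys. distinct ys \<and> set ys \<subseteq> V \<and> adj E ys \<in> set (search k n (adj E xs))"
  using assms(1,2)
proof (induction n arbitrary: xs)
  case (Suc n)
  show ?case
  proof (cases "demand (adj E xs)")
    case (Some P)
    then obtain w where w: "w \<in> V" "w \<notin> set xs" "P (map (E w) xs)"
      using demand_satisfied Suc.prems by blast
    then have "map (E w) xs \<in> set (new_rows k P (adj E xs))"
      using new_rows_complete Suc.prems assms(3) by blast
    moreover obtain ys where "distinct ys" "set ys \<subseteq> V" "adj E ys \<in> set (search k n (adj E (xs @ [w])))"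
      using Suc.IH[of "xs @ [w]"] Suc.prems w by auto
    ultimately show ?thesis
      using Some by (auto simp: adj_snoc)
  qed (use Suc.prems in auto)
qed auto

end

section \<open>The exhaustive search\<close>

text \<open>Each list starts with the same induced \<open>P\<^sub>5\<close>; the other vertices
  follow in the order in which a branch of the search adds them.\<close>

definition petersen_labellings :: "nat set list list" where
  "petersen_labellings = [
     [{0, 1}, {2, 3}, {0, 4}, {1, 2}, {0, 3}, {3, 4}, {2, 4}, {1, 4}, {1, 3}, {0, 2}],
     [{0, 1}, {2, 3}, {0, 4}, {1, 2}, {0, 3}, {3, 4}, {1, 4}, {2, 4}, {1, 3}, {0, 2}],
     [{0, 1}, {2, 3}, {0, 4}, {1, 2}, {0, 3}, {2, 4}, {3, 4}, {1, 4}, {1, 3}, {0, 2}]]"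

text \<open>An executable relation that agrees with \<open>petersen_E\<close> on
  \<open>petersen_V\<close>.\<close>

definition disjoint_sets :: "nat set \<Rightarrow> nat set \<Rightarrow> bool" where
  "disjoint_sets S T \<longleftrightarrow> S \<inter> T = {}"

text \<open>The first argument is one less than the order of the forbidden path, so \<open>4\<close>
  forbids \<open>P\<^sub>5\<close>.\<close>

lemma search_path_5_from_vertex: "search 4 10 [[False]] = []"
  by code_simp

lemma search_path_6_from_path: "search 5 10 (adj path_E [0..<5]) = map (adj disjoint_sets) petersen_labellings"
  by code_simp

lemma search_path_7_from_path: "search 6 10 (adj path_E [0..<6]) = []"
  by code_simp

text \<open>Excludes a further vertex with a neighbour in the Petersen graph; connectedness then
  leaves nothing outside it.\<close>

lemma petersen_labellings_maximal:
  "list_all (\<lambda>L. new_rows 5 (\<lambda>t. True \<in> set t) (adj disjoint_sets L) = []) petersen_labellings"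
  by code_simp

lemma petersen_labelling:
  assumes "L \<in> set petersen_labellings"
  shows "distinct L" "set L = petersen_V"
proof -
  show "distinct L"
    using assms by (auto simp: petersen_labellings_def doubleton_eq_iff)
  have L: "length L = 10" "set L \<subseteq> petersen_V"
    using assms by (auto simp: petersen_labellings_def petersen_V_def)
  have "card petersen_V = 5 choose 2"
    using n_subsets[of "{0..<5::nat}" 2] by (simp add: petersen_V_def)
  then have "card petersen_V = card (set L)"
    using L(1) distinct_card[OF \<open>distinct L\<close>] by (simp add: numeral_eq_Suc)
  moreover have "finite petersen_V"
    by (simp add: petersen_V_def)
  ultimately show "set L = petersen_V"
    using L(2) card_subset_eq by metis
qed

context sparse_graph
begin

lemma has_induced_path_5:
  assumes "V \<noteq> {}"
  shows "has_induced {0..<5} path_E V E"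
proof (rule ccontr)
  assume "\<not> ?thesis"
  then have no_path: "\<not> has_induced {0..<Suc 4} path_E V E"
    by simp
  obtain x where x: "x \<in> V"
    using assms by blast
  have "adj E [x] = [[False]]"
    using irrefl by (simp add: adj_def)
  then show False
    using search_complete[of "[x]", OF _ _ no_path, of 10] search_path_5_from_vertex x by simp
qed

lemma no_induced_path_6:
  assumes "\<not> has_induced {0..<7} path_E V E"
  shows "\<not> has_induced {0..<6} path_E V E"
proof
  assume "has_induced {0..<6} path_E V E"
  then obtain xs where "distinct xs" "set xs \<subseteq> V" "adj E xs = adj path_E [0..<6]"
    unfolding has_induced_iff_adj by blast
  then show False
    using search_complete[of xs 6 10] search_path_7_from_path assms by simp
qed

lemma petersen_if_no_induced_path_6:
  assumes "connected_graph V E" "\<not> has_induced {0..<6} path_E V E"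
  shows "graph_iso petersen_V petersen_E V E"
proof -
  have no_path: "\<not> has_induced {0..<Suc 5} path_E V E"
    using assms(2) by simp
  obtain xs where "distinct xs" "set xs \<subseteq> V" "adj E xs = adj path_E [0..<5]"
    using has_induced_path_5 assms(1) unfolding has_induced_iff_adj connected_graph_def by blast
  then have "\<exists>ys. distinct ys \<and> set ys \<subseteq> V \<and> adj E ys \<in> adj disjoint_sets ` set petersen_labellings"
    using search_complete[of xs, OF _ _ no_path, of 10] search_path_6_from_path by simp
  then obtain ys L where ys: "distinct ys" "set ys \<subseteq> V"
      and L: "L \<in> set petersen_labellings" "adj E ys = adj disjoint_sets L"
    by blast
  have closed: "w \<in> set ys" if "x \<in> set ys" "E x w" for x w
  proof (rule ccontr)
    assume "w \<notin> set ys"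
    moreover have "True \<in> set (map (E w) ys)"
      using that sym by force
    ultimately have "map (E w) ys \<in> set (new_rows 5 (\<lambda>t. True \<in> set t) (adj E ys))"
      using new_rows_complete[OF ys _ _ _ no_path, of w "\<lambda>t. True \<in> set t"] vertices that by blast
    then show False
      using petersen_labellings_maximal L by (simp add: list_all_iff)
  qed
  have "length ys = length L" "set L \<noteq> {}"
    using L petersen_labelling(2)[OF L(1)] by (auto simp: adj_eq_iff petersen_labellings_def)
  then obtain x where x: "x \<in> set ys"
    by (cases ys) auto
  have "y \<in> set ys" if "y \<in> V" for y
  proof -
    have "reach_in V E x y"
      using assms(1) ys(2) x that unfolding connected_graph_def by blast
    then show ?thesis
      unfolding reach_in_def by (induction rule: rtranclp_induct) (use x closed in auto)
  qed
  then have "V = set ys"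
    using ys(2) by blast
  then have "graph_iso petersen_V disjoint_sets V E"
    using graph_iso_if_adj_eq[OF L(2) ys(1)] petersen_labelling[OF L(1)] by simp
  then show ?thesis
    by (simp add: graph_iso_def petersen_E_def disjoint_sets_def)
qed

end

section \<open>The degree bound\<close>

lemma common_neighbour_unique:
  assumes "sgraph V E"
    and "\<not> has_induced {0..<4} (cycle_E 4) V E" "\<not> has_induced {0..<4} diamond_E V E"
    and xy: "x \<noteq> y" "\<not> E x y" and common: "E u x" "E u y" "E v x" "E v y"
  shows "u = v"
proof (rule ccontr)
  assume "u \<noteq> v"
  have sym: "\<And>x y. E x y \<Longrightarrow> E y x" and irrefl: "\<And>x. \<not> E x x"
    and vertices: "\<And>x y. E x y \<Longrightarrow> x \<in> V \<and> y \<in> V"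
    using assms(1) by (auto simp: sgraph_def)
  have common': "E x u" "E y u" "E x v" "E y v" "\<not> E y x"
    using sym xy common by blast+
  have dist: "distinct [x, u, v, y]" "set [x, u, v, y] \<subseteq> V"
    using xy common irrefl vertices \<open>u \<noteq> v\<close> by auto
  have diamond: "adj diamond_E [0..<4] = [[False, True, True, False], [True, False, True, True],
      [True, True, False, True], [False, True, True, False]]"
    by code_simp
  have cycle: "adj (cycle_E 4) [0..<4] = [[False, True, False, True], [True, False, True, False],
      [False, True, False, True], [True, False, True, False]]"
    by code_simp
  show False
  proof (cases "E u v")
    case True
    moreover from this have "E v u"
      by (rule sym)
    \<comment> \<open>The non-adjacent pair occupies positions 0 and 3, the missing edge of
      \<open>diamond_E\<close>.\<close>
    ultimately have "adj E [x, u, v, y] = adj diamond_E [0..<4]"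
      using irrefl xy common common' unfolding diamond by (simp add: adj_def)
    then show False
      using assms(3) dist unfolding has_induced_iff_adj by blast
  next
    case False
    moreover have "\<not> E v u"
      using False sym by blast
    ultimately have "adj E [x, u, y, v] = adj (cycle_E 4) [0..<4]"
      using irrefl xy common common' unfolding cycle by (simp add: adj_def)
    moreover have "distinct [x, u, y, v]" "set [x, u, y, v] \<subseteq> V"
      using dist by auto
    ultimately show False
      using assms(2) unfolding has_induced_iff_adj by blast
  qed
qed

lemma clique_card_le:
  assumes "finite V" "is_clique V E K"
  shows "card K \<le> clique_number V E"
proof -
  have "{K. is_clique V E K} \<subseteq> Pow V"
    by (auto simp: is_clique_def)
  then have "finite {K. is_clique V E K}"
    using assms(1) finite_subset by blast
  then show ?thesis
    unfolding clique_number_def using assms(2) by (intro Max_ge) auto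
qed

theorem theorem1p1:
  fixes V :: "'a set" and E :: "'a \<Rightarrow> 'a \<Rightarrow> bool"
  assumes "sgraph V E"
    and "connected_graph V E"
    and "\<not> has_induced {0..<7} path_E V E"
    and "\<not> has_induced {0..<4} (cycle_E 4) V E"
    and "\<not> has_induced {0..<4} diamond_E V E"
    and "\<not> (\<exists>K. clique_cutset V E K)"
    and "\<not> graph_iso {0..<10} F_E V E"
    and "\<not> graph_iso petersen_V petersen_E V E"
  shows "min_degree V E \<le> max 2 (clique_number V E - 1)"
proof (rule ccontr)
  assume large: "\<not> ?thesis"
  have fin: "finite V" and sym: "\<And>x y. E x y \<Longrightarrow> E y x" and irrefl: "\<And>x. \<not> E x x"
    and vertices: "\<And>x y. E x y \<Longrightarrow> y \<in> V"
    using assms(1) by (auto simp: sgraph_def)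
  note unique = common_neighbour_unique[OF assms(1,4,5)]
  have degree: "degree V E x = card {y. E x y}" for x
    unfolding degree_def by (rule arg_cong[where f = card]) (use vertices in auto)
  \<comment> \<open>Exceeding \<open>clique_number V E - 1\<close> gives at least
    \<open>clique_number V E\<close>, even where natural subtraction truncates.\<close>
  have degree_ge: "3 \<le> card {y. E x y} \<and> clique_number V E \<le> card {y. E x y}" if "x \<in> V" for x
  proof -
    have "min_degree V E \<le> degree V E x"
      unfolding min_degree_def using fin that by (intro Min_le) auto
    then show ?thesis
      using large degree[of x] by auto
  qed
  interpret sparse_graph V E
  proof
    fix x u assume xu: "E x u"
    have x: "x \<in> V"
      using xu sym vertices by blast
    show "\<exists>w. E x w \<and> w \<noteq> u \<and> \<not> E u w"
    proof (rule ccontr)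
      assume "\<not> ?thesis"
      then have u: "w = u \<or> E u w" if "E x w" for w
        using that by blast
      \<comment> \<open>If \<open>y\<close> and \<open>z\<close> were non-adjacent, both
        \<open>x\<close> and \<open>u\<close> would be common neighbours of them.\<close>
      have "E y z" if "E x y" "E x z" "y \<noteq> z" for y z
      proof (rule ccontr)
        assume nadj: "\<not> E y z"
        have uyz: "E u y" "E u z"
          using nadj u[OF that(1)] u[OF that(2)] that(3) sym by blast+
        have "x = u"
          by (rule unique[OF that(3) nadj that(1,2) uyz])
        then show False
          using xu irrefl by blast
      qed
      then have "is_clique V E (insert x {y. E x y})"
        using x vertices sym unfolding is_clique_def by blast
      \<comment> \<open>This clique has one vertex more than the degree of \<open>x\<close>, which
        is already at least the clique number.\<close>
      then have "card (insert x {y. E x y}) \<le> clique_number V E"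
        using clique_card_le fin by blast
      moreover have "finite {y. E x y}"
        using fin vertices by (auto intro: finite_subset[of _ V])
      ultimately show False
        using degree_ge[OF x] irrefl[of x] by simp
    qed
  qed (use sym irrefl vertices unique degree_ge in blast)+
  show False
    using petersen_if_no_induced_path_6[OF assms(2) no_induced_path_6[OF assms(3)]] assms(8) by blast
qed

end
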